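(* Let $b,c$ be rational numbers with $c\neq 0$, $c\neq 1$ and $2b\,(c-1)^2=c^2$. Then the cubic polynomials $P(x)$ and $Q(d)$ (defined in the context) are reducible over $\mathbb{Q}$. Moreover, each of $P$ and $Q$ has three rational roots (counted with multiplicity), these roots can be labelled $x_1,x_2,x_3$ (roots of $P$) and $d_1,d_2,d_3$ (roots of $Q$) so that the auxiliary equations hold, but these six numbers are not all positive, so they do not provide a solution of the perfect cuboid problem (Problem 1.2).
   Context: Let $b,c$ be rational numbers. Put $\Delta=b^2c^4-6b^2c^3+13b^2c^2-12b^2c+4b^2+c^2$ and $N=(bc-1-b)(bc-c-2b)$, and assume $\Delta\,N\neq 0$, so that all the following rational numbers are defined (with $D=b^2c^2+2b^2-3b^2c+c-bc^2+2b$): $E_{11}=-\frac{b(c^2+2-4c)}{D}$, $E_{01}=-\frac{b(c^2+2-2c)}{D}$, $E_{10}=-\frac{b^2c^2+2b^2-3b^2c-c}{D}$; $E_{20}=\frac{b}{2}(bc^2-2c-2b)(2bc^2-c^2-6bc+2+4b)(bc-1-b)^{-2}(bc-c-2b)^{-2}$; $E_{02}=\frac12(28b^2c^2-16b^2c-2c^2-4b^2-b^2c^4+4b^3c^4-12b^3c^3+4bc^3+24b^3c-8bc-2b^4c^4+12b^4c^3-26b^4c^2-8b^2c^3+24b^4c-16b^3-8b^4)(bc-1-b)^{-2}(bc-c-2b)^{-2}$; $E_{21}=\frac{b}{2}(5c^6b-2c^6b^2+52c^5b^2-16c^5b-2c^7b^2+2b^4c^8+142b^4c^6-26b^4c^7-426b^4c^5-61b^3c^6+100b^3c^5+14c^7b^3-c^8b^3-20bc^2-8b^2c^2-16b^2c-128b^2c^4-200b^3c^3+244b^3c^2+32bc^3-112b^3c+768b^4c^4-852b^4c^3+568b^4c^2+104b^2c^3-208b^4c+8c^4-4c^3+16b^3+32b^4-2c^5)\,\Delta^{-1}(bc-1-b)^{-2}(bc-c-2b)^{-2}$;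 $E_{12}=(16b^6+32b^5-6c^5b^2+2c^5b-62b^5c^6+62b^6c^6-180b^6c^5+18b^5c^7-12b^6c^7-2b^5c^8+b^6c^8+248b^5c^2+248b^6c^2-96b^6c+321b^6c^4-180b^5c^3-144b^5c-360b^6c^3+b^4c^8+8b^4c^6-6b^4c^7+18b^4c^5+7b^3c^6+90b^5c^5-14b^3c^5-c^7b^3+17b^2c^4+28b^3c^3-28b^3c^2-4bc^3+8b^3c-57b^4c^4+36b^4c^3+32b^4c^2-12b^2c^3-48b^4c-c^4+16b^4)\,\Delta^{-1}(bc-1-b)^{-2}(bc-c-2b)^{-2}$; $E_{03}=\frac{b}{2}(b^2c^4-5b^2c^3+10b^2c^2-10b^2c+4b^2+2bc+2c^2-bc^3)(2b^2c^4-12b^2c^3+26b^2c^2-24b^2c+8b^2-c^4b+3bc^3-6bc+4b+c^3-2c^2+2c)\,\Delta^{-1}(bc-1-b)^{-2}(bc-c-2b)^{-2}$; $E_{30}=c\,b^2(1-c)(c-2)(bc^2-4bc+2+4b)(2bc^2-c^2-4bc+2b)\,\Delta^{-1}(bc-1-b)^{-2}(bc-c-2b)^{-2}$. Define $P(x)=x^3-E_{10}x^2+E_{20}x-E_{30}$ and $Q(d)=d^3-E_{01}d^2+E_{02}d-E_{03}$. For numbers $x_1,x_2,x_3,d_1,d_2,d_3$ the auxiliary equations are: $x_1x_2d_3+x_2x_3d_1+x_3x_1d_2=E_{21}$, $x_1d_2+d_1x_2+x_2d_3+d_2x_3+x_3d_1+d_3x_1=E_{11}$, $x_1d_2d_3+x_2d_3d_1+x_3d_1d_2=E_{12}$.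 Problem 1.2 (equivalent to finding a perfect cuboid) asks for rational $b,c$ such that $P$ and $Q$ have positive rational roots $x_1,x_2,x_3$ and $d_1,d_2,d_3$ satisfying the auxiliary equations. *)

theory Defs
  imports "HOL-Computational_Algebra.Computational_Algebra"
begin

definition cub_Delta :: "rat \<Rightarrow> rat \<Rightarrow> rat" where
  "cub_Delta b c =
    b^2 * c^4 - 6 * b^2 * c^3 + 13 * b^2 * c^2 - 12 * b^2 * c + 4 * b^2 + c^2"

definition cub_N :: "rat \<Rightarrow> rat \<Rightarrow> rat" where
  "cub_N b c =
    (b * c - 1 - b) * (b * c - c - 2 * b)"

text \<open>This is the expanded form of \<open>cub_N\<close>.\<close>

definition cub_D :: "rat \<Rightarrow> rat \<Rightarrow> rat" where
  "cub_D b c =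
    b^2 * c^2 + 2 * b^2 - 3 * b^2 * c + c - b * c^2 + 2 * b"

definition cub_E11 :: "rat \<Rightarrow> rat \<Rightarrow> rat" where
  "cub_E11 b c =
    - b * (c^2 + 2 - 4 * c) / cub_D b c"

definition cub_E01 :: "rat \<Rightarrow> rat \<Rightarrow> rat" where
  "cub_E01 b c =
    - b * (c^2 + 2 - 2 * c) / cub_D b c"

definition cub_E10 :: "rat \<Rightarrow> rat \<Rightarrow> rat" where
  "cub_E10 b c =
    - (b^2 * c^2 + 2 * b^2 - 3 * b^2 * c - c) / cub_D b c"

definition cub_E20 :: "rat \<Rightarrow> rat \<Rightarrow> rat" where
  "cub_E20 b c =
    (b / 2) * (b * c^2 - 2 * c - 2 * b) * (2 * b * c^2 - c^2 - 6 * b * c + 2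
      + 4 * b) / (cub_N b c)^2"

definition cub_E02 :: "rat \<Rightarrow> rat \<Rightarrow> rat" where
  "cub_E02 b c =
    (1 / 2) * (28 * b^2 * c^2 - 16 * b^2 * c - 2 * c^2 - 4 * b^2 - b^2 * c^4
      + 4 * b^3 * c^4 - 12 * b^3 * c^3 + 4 * b * c^3 + 24 * b^3 * c - 8 * b * c
      - 2 * b^4 * c^4 + 12 * b^4 * c^3 - 26 * b^4 * c^2 - 8 * b^2 * c^3
      + 24 * b^4 * c - 16 * b^3 - 8 * b^4) / (cub_N b c)^2"

definition cub_E21 :: "rat \<Rightarrow> rat \<Rightarrow> rat" where
  "cub_E21 b c =
    (b / 2) * (5 * c^6 * b - 2 * c^6 * b^2 + 52 * c^5 * b^2 - 16 * c^5 * b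
      - 2 * c^7 * b^2 + 2 * b^4 * c^8 + 142 * b^4 * c^6 - 26 * b^4 * c^7
      - 426 * b^4 * c^5 - 61 * b^3 * c^6 + 100 * b^3 * c^5 + 14 * c^7 * b^3
      - c^8 * b^3 - 20 * b * c^2 - 8 * b^2 * c^2 - 16 * b^2 * c
      - 128 * b^2 * c^4 - 200 * b^3 * c^3 + 244 * b^3 * c^2 + 32 * b * c^3
      - 112 * b^3 * c + 768 * b^4 * c^4 - 852 * b^4 * c^3 + 568 * b^4 * c^2
      + 104 * b^2 * c^3 - 208 * b^4 * c + 8 * c^4 - 4 * c^3 + 16 * b^3
      + 32 * b^4 - 2 * c^5) / (cub_Delta b c * (cub_N b c)^2)"

definition cub_E12 :: "rat \<Rightarrow> rat \<Rightarrow> rat" where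
  "cub_E12 b c =
    (16 * b^6 + 32 * b^5 - 6 * c^5 * b^2 + 2 * c^5 * b - 62 * b^5 * c^6
      + 62 * b^6 * c^6 - 180 * b^6 * c^5 + 18 * b^5 * c^7 - 12 * b^6 * c^7
      - 2 * b^5 * c^8 + b^6 * c^8 + 248 * b^5 * c^2 + 248 * b^6 * c^2
      - 96 * b^6 * c + 321 * b^6 * c^4 - 180 * b^5 * c^3 - 144 * b^5 * c
      - 360 * b^6 * c^3 + b^4 * c^8 + 8 * b^4 * c^6 - 6 * b^4 * c^7
      + 18 * b^4 * c^5 + 7 * b^3 * c^6 + 90 * b^5 * c^5 - 14 * b^3 * c^5
      - c^7 * b^3 + 17 * b^2 * c^4 + 28 * b^3 * c^3 - 28 * b^3 * c^2
      - 4 * b * c^3 + 8 * b^3 * c - 57 * b^4 * c^4 + 36 * b^4 * c^3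
      + 32 * b^4 * c^2 - 12 * b^2 * c^3 - 48 * b^4 * c - c^4
      + 16 * b^4) / (cub_Delta b c * (cub_N b c)^2)"

definition cub_E03 :: "rat \<Rightarrow> rat \<Rightarrow> rat" where
  "cub_E03 b c =
    (b / 2) * (b^2 * c^4 - 5 * b^2 * c^3 + 10 * b^2 * c^2 - 10 * b^2 * c
      + 4 * b^2 + 2 * b * c + 2 * c^2 - b * c^3) * (2 * b^2 * c^4
      - 12 * b^2 * c^3 + 26 * b^2 * c^2 - 24 * b^2 * c + 8 * b^2 - c^4 * b
      + 3 * b * c^3 - 6 * b * c + 4 * b + c^3 - 2 * c^2
      + 2 * c) / (cub_Delta b c * (cub_N b c)^2)"

definition cub_E30 :: "rat \<Rightarrow> rat \<Rightarrow> rat" where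
  "cub_E30 b c =
    c * b^2 * (1 - c) * (c - 2) * (b * c^2 - 4 * b * c + 2 + 4 * b) *
      (2 * b * c^2 - c^2 - 4 * b * c + 2 * b) / (cub_Delta b c * (cub_N b c)^2)"

definition cub_P :: "rat \<Rightarrow> rat \<Rightarrow> rat poly" where
  "cub_P b c = [:- cub_E30 b c, cub_E20 b c, - cub_E10 b c, 1:]"

definition cub_Q :: "rat \<Rightarrow> rat \<Rightarrow> rat poly" where
  "cub_Q b c = [:- cub_E03 b c, cub_E02 b c, - cub_E01 b c, 1:]"

text \<open>The three numbers are all the roots of the monic cubic, listed with multiplicity.\<close>

definition three_roots :: "rat poly \<Rightarrow> rat \<Rightarrow> rat \<Rightarrow> rat \<Rightarrow> bool" where
  "three_roots p r1 r2 r3 \<longleftrightarrow> p = [:- r1, 1:] * [:- r2, 1:] * [:- r3, 1:]"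

definition auxiliary_equations ::
  "rat \<Rightarrow> rat \<Rightarrow> rat \<Rightarrow> rat \<Rightarrow> rat \<Rightarrow> rat \<Rightarrow> rat \<Rightarrow> rat \<Rightarrow> bool" where
  "auxiliary_equations b c x1 x2 x3 d1 d2 d3 \<longleftrightarrow>
     x1 * x2 * d3 + x2 * x3 * d1 + x3 * x1 * d2 = cub_E21 b c \<and>
     x1 * d2 + d1 * x2 + x2 * d3 + d2 * x3 + x3 * d1 + d3 * x1 = cub_E11 b c \<and>
     x1 * d2 * d3 + x2 * d3 * d1 + x3 * d1 * d2 = cub_E12 b c"

text \<open>
  The pair \<open>(b, c)\<close> solves the perfect cuboid problem in its polynomial form.
  The first conjunct ensures that no division by zero occurs in the coefficients.
\<close>

definition solves_cuboid_problem :: "rat \<Rightarrow> rat \<Rightarrow> bool" where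
  "solves_cuboid_problem b c \<longleftrightarrow>
     cub_Delta b c * cub_N b c \<noteq> 0 \<and>
     (\<exists>x1 x2 x3 d1 d2 d3.
        three_roots (cub_P b c) x1 x2 x3 \<and> three_roots (cub_Q b c) d1 d2 d3 \<and>
        auxiliary_equations b c x1 x2 x3 d1 d2 d3 \<and>
        x1 > 0 \<and> x2 > 0 \<and> x3 > 0 \<and> d1 > 0 \<and> d2 > 0 \<and> d3 > 0)"

end

theory Submission
  imports Defs
begin

text \<open>
  Put \<open>u = c - 1\<close>, so that \<open>b = (u + 1)\<^sup>2 / (2 u\<^sup>2)\<close>, and let \<open>p\<close>, \<open>q\<close> be the rational point
  \<open>p = (u\<^sup>2 - 1) / (u\<^sup>2 + 1)\<close>, \<open>q = 2 u / (u\<^sup>2 + 1)\<close> of the unit circle. The roots, paired so that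
  \<open>x\<^sub>i\<^sup>2 + d\<^sub>i\<^sup>2 = 1\<close>, are \<open>(0, 1)\<close>, \<open>(p, q)\<close>, \<open>(- q, p)\<close>. As the constant term of \<open>P\<close> vanishes,
  \<open>0\<close> occurs in every labelling of its roots, so they are never all positive.
\<close>

text \<open>Vieta's formulas, with signs as in \<open>cub_P\<close> and \<open>cub_Q\<close>, so
  that claims about roots become identities between coefficients.\<close>

lemma three_roots_iff:
  "three_roots [:- e3, e2, - e1, 1:] r1 r2 r3 \<longleftrightarrow>
     e1 = r1 + r2 + r3 \<and> e2 = r1 * r2 + r2 * r3 + r3 * r1 \<and> e3 = r1 * r2 * r3"
proof -
  have "[:- r1, 1:] * [:- r2, 1:] * [:- r3, 1:] =
      [:- (r1 * r2 * r3), r1 * r2 + r2 * r3 + r3 * r1, - (r1 + r2 + r3), 1:]"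
    by (simp add: algebra_simps)
  then show ?thesis
    unfolding three_roots_def by simp (auto simp: algebra_simps)
qed

lemma three_roots_not_irreducible:
  assumes "three_roots p r1 r2 r3"
  shows "\<not> irreducible p"
proof
  assume "irreducible p"
  moreover have "p = [:- r1, 1:] * ([:- r2, 1:] * [:- r3, 1:])"
    using assms unfolding three_roots_def by (simp only: mult.assoc)
  ultimately have "[:- r1, 1:] dvd 1 \<or> [:- r2, 1:] * [:- r3, 1:] dvd 1"
    by (rule irreducibleD)
  then show False
    by (auto simp: is_unit_iff_degree)
qed

locale cuboid_curve =
  fixes b c u p q :: rat
  assumes u: "u \<noteq> 0" "u + 1 \<noteq> 0"
    and b: "b = (u + 1)^2 / (2 * u^2)"
    and c: "c = u + 1"
    and p: "p = (u^2 - 1) / (u^2 + 1)"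
    and q: "q = 2 * u / (u^2 + 1)"
begin

lemma s_nonzero: "u^2 + 1 \<noteq> 0"
  using zero_le_power2[of u] by linarith

lemma curve: "2 * b * u^2 = (u + 1)^2"
  using u(1) by (simp add: b)

text \<open>On the curve \<open>cub_Delta\<close> and \<open>cub_N\<close> are, up to constants,
  products of powers of \<open>u\<close>, \<open>u + 1\<close> and \<open>u^2 + 1\<close>, all
  nonzero.\<close>

lemma Delta: "cub_Delta b c = (u + 1)^2 * (u^2 + 1)^2 / (4 * u^2)"
  unfolding cub_Delta_def b c using u(1)
  by (simp add: divide_simps) algebra

lemma N: "cub_N b c = - ((u + 1) * (u^2 + 1)^2 / (4 * u^3))"
  unfolding cub_N_def b c using u(1)
  by (simp add: divide_simps) algebra

lemma D: "cub_D b c = cub_N b c"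
  unfolding cub_D_def cub_N_def by algebra

lemma E10: "cub_E10 b c = p - q"
  unfolding cub_E10_def D N p q unfolding b c using u s_nonzero
  by (simp add: divide_simps) algebra

lemma E11: "cub_E11 b c = p + p^2 - q^2 - q"
  unfolding cub_E11_def D N p q unfolding b c using u s_nonzero
  by (simp add: divide_simps) algebra

lemma E01: "cub_E01 b c = 1 + p + q"
  unfolding cub_E01_def D N p q unfolding b c using u s_nonzero
  by (simp add: divide_simps) algebra

text \<open>Clears denominators for \<open>cub_E20\<close> and \<open>cub_E02\<close>. Their
  numerators have degree at most 4 in \<open>b\<close>, so the factor
  \<open>16 * u^8 = (2 * u^2)^4\<close> lets \<open>curve\<close> eliminate \<open>b\<close>; the
  surplus \<open>u^2\<close> cancels.\<close>

lemma N_quotient_eqI: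
  assumes "16 * u^8 * n = t * u^2 * (u + 1)^2 * (u^2 + 1)^2"
  shows "n / (cub_N b c)^2 = t / (u^2 + 1)^2"
proof -
  have "u^2 * (16 * u^6 * n) = u^2 * (t * (u + 1)^2 * (u^2 + 1)^2)"
    using assms by algebra
  then have "16 * u^6 * n = t * (u + 1)^2 * (u^2 + 1)^2"
    using u(1) by simp
  then have n: "n = t * (u + 1)^2 * (u^2 + 1)^2 / (16 * u^6)"
    using u(1) by (simp add: field_simps)
  have NN: "(cub_N b c)^2 = (u + 1)^2 * (u^2 + 1)^4 / (16 * u^6)"
    unfolding N using u(1) by (simp add: divide_simps)
  show ?thesis
    unfolding n NN using u s_nonzero by (simp add: divide_simps)
qed

lemma E20: "cub_E20 b c = - (p * q)"
proof -
  have "- (p * q) = - (2 * u * (u^2 - 1)) / (u^2 + 1)^2"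
    by (simp add: p q power2_eq_square)
  then show ?thesis
    \<comment> \<open>\<open>b\<close> stays a variable, tied to \<open>u\<close> only by
      \<open>curve\<close>, which keeps the goal polynomial.\<close>
    unfolding cub_E20_def c using curve
    by (simp only:, intro N_quotient_eqI[unfolded c]) algebra
qed

lemma E02: "cub_E02 b c = p + q + p * q"
proof -
  have "p + q + p * q = ((u^2 - 1 + 2 * u) * (u^2 + 1) + 2 * u * (u^2 - 1)) / (u^2 + 1)^2"
    unfolding p q using s_nonzero by (simp add: divide_simps) algebra
  then show ?thesis
    unfolding cub_E02_def c using curve
    by (simp only:, intro N_quotient_eqI[unfolded c]) algebra
qed

lemma E30: "cub_E30 b c = 0"
proof -
  \<comment> \<open>The last factor of the numerator is
    \<open>2 * b * (c - 1)^2 - c^2\<close>.\<close>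
  have "2 * b * c^2 - c^2 - 4 * b * c + 2 * b = 0"
    using curve c by algebra
  then show ?thesis
    by (simp add: cub_E30_def)
qed

text \<open>The analogue for numerators of degree at most 6 in \<open>b\<close>, with
  \<open>64 * u^12 = (2 * u^2)^6\<close>; here the surplus is \<open>u^4\<close>.\<close>

lemma Delta_N_quotient_eqI:
  assumes "64 * u^12 * n = t * u^4 * (u + 1)^4 * (u^2 + 1)^4"
  shows "n / (cub_Delta b c * (cub_N b c)^2) = t / (u^2 + 1)^2"
proof -
  have "u^4 * (64 * u^8 * n) = u^4 * (t * (u + 1)^4 * (u^2 + 1)^4)"
    using assms by algebra
  then have "64 * u^8 * n = t * (u + 1)^4 * (u^2 + 1)^4"
    using u(1) by simp
  then have n: "n = t * (u + 1)^4 * (u^2 + 1)^4 / (64 * u^8)"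
    using u(1) by (simp add: field_simps)
  have DN: "cub_Delta b c * (cub_N b c)^2 = (u + 1)^4 * (u^2 + 1)^6 / (64 * u^8)"
    unfolding Delta N using u(1) by (simp add: divide_simps) algebra
  show ?thesis
    unfolding n DN using u s_nonzero by (simp add: divide_simps)
qed

lemma E03: "cub_E03 b c = p * q"
proof -
  have "p * q = 2 * u * (u^2 - 1) / (u^2 + 1)^2"
    by (simp add: p q power2_eq_square)
  then show ?thesis
    unfolding cub_E03_def c using curve
    by (simp only:, intro Delta_N_quotient_eqI[unfolded c]) algebra
qed

lemma E21: "cub_E21 b c = - (p * q)"
proof -
  have "- (p * q) = - (2 * u * (u^2 - 1)) / (u^2 + 1)^2"
    by (simp add: p q power2_eq_square)
  then show ?thesis
    unfolding cub_E21_def c using curve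
    by (simp only:, intro Delta_N_quotient_eqI[unfolded c]) algebra
qed

lemma E12: "cub_E12 b c = p^2 - q^2"
proof -
  \<comment> \<open>The numerator by powers of \<open>b\<close>, so that \<open>curve\<close> eliminates \<open>b\<close> after clearing denominators by \<open>(2 u\<^sup>2)\<^sup>6\<close>.\<close>
  let ?A = "- (c^4)"
  let ?B = "2 * c^5 - 4 * c^3"
  let ?C = "- 6 * c^5 + 17 * c^4 - 12 * c^3"
  let ?D = "- (c^7) + 7 * c^6 - 14 * c^5 + 28 * c^3 - 28 * c^2 + 8 * c"
  let ?E = "c^8 - 6 * c^7 + 8 * c^6 + 18 * c^5 - 57 * c^4 + 36 * c^3 + 32 * c^2 - 48 * c + 16"
  let ?F = "- 2 * c^8 + 18 * c^7 - 62 * c^6 + 90 * c^5 - 180 * c^3 + 248 * c^2 - 144 * c + 32"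
  let ?G = "(c - 1)^4 * (c - 2)^4"
  let ?n = "?A + ?B * b + ?C * b^2 + ?D * b^3 + ?E * b^4 + ?F * b^5 + ?G * b^6"
  let ?t = "(u^2 - 1)^2 - (2 * u)^2"
  have "64 * u^12 * ?n =
      64 * ?A * u^12 + 32 * ?B * (2 * b * u^2) * u^10 + 16 * ?C * (2 * b * u^2)^2 * u^8
      + 8 * ?D * (2 * b * u^2)^3 * u^6 + 4 * ?E * (2 * b * u^2)^4 * u^4
      + 2 * ?F * (2 * b * u^2)^5 * u^2 + ?G * (2 * b * u^2)^6"
    by algebra
  also have "\<dots> = ?t * u^4 * (u + 1)^4 * (u^2 + 1)^4"
    unfolding curve c by algebra
  finally have "?n / (cub_Delta b c * (cub_N b c)^2) = ?t / (u^2 + 1)^2"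
    by (rule Delta_N_quotient_eqI)
  moreover have "cub_E12 b c = ?n / (cub_Delta b c * (cub_N b c)^2)"
    unfolding cub_E12_def by (rule arg_cong2[where f = divide]) (algebra, rule refl)
  moreover have "p^2 - q^2 = ?t / (u^2 + 1)^2"
    unfolding p q power_divide by (rule diff_divide_distrib[symmetric])
  ultimately show ?thesis
    by simp
qed

lemma roots_P: "three_roots (cub_P b c) 0 p (- q)"
  unfolding cub_P_def three_roots_iff by (simp add: E10 E20 E30)

lemma roots_Q: "three_roots (cub_Q b c) 1 q p"
  unfolding cub_Q_def three_roots_iff by (simp add: E01 E02 E03 algebra_simps)

text \<open>With \<open>x1 = 0\<close> and \<open>d1 = 1\<close> the sums collapse to
  \<open>- (p * q)\<close>, \<open>p + p^2 - q^2 - q\<close> and \<open>p^2 - q^2\<close>.\<close>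

lemma auxiliary: "auxiliary_equations b c 0 p (- q) 1 q p"
  by (simp add: auxiliary_equations_def E21 E11 E12 power2_eq_square)

lemma not_solves: "\<not> solves_cuboid_problem b c"
  unfolding solves_cuboid_problem_def cub_P_def three_roots_iff by (auto simp: E30)

end

theorem theorem8p1:
  fixes b c :: rat
  assumes "cub_Delta b c * cub_N b c \<noteq> 0"
    and "c \<noteq> 0" and "c \<noteq> 1" and "2 * b * (c - 1)^2 = c^2"
  shows "\<not> irreducible (cub_P b c) \<and> \<not> irreducible (cub_Q b c) \<and>
    (\<exists>x1 x2 x3 d1 d2 d3.
       three_roots (cub_P b c) x1 x2 x3 \<and> three_roots (cub_Q b c) d1 d2 d3 \<and>
       auxiliary_equations b c x1 x2 x3 d1 d2 d3 \<and>
       \<not> (x1 > 0 \<and> x2 > 0 \<and> x3 > 0 \<and> d1 > 0 \<and> d2 > 0 \<and> d3 > 0)) \<and>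
    \<not> solves_cuboid_problem b c"
proof -
  define u where "u = c - 1"
  \<comment> \<open>\<open>c \<noteq> 1\<close> and \<open>c \<noteq> 0\<close> give
    \<open>u \<noteq> 0\<close> and \<open>u + 1 \<noteq> 0\<close>; dividing the curve equation by
    \<open>2 * u^2\<close> gives \<open>b\<close>.\<close>
  interpret cuboid_curve b c u "(u^2 - 1) / (u^2 + 1)" "2 * u / (u^2 + 1)"
    using assms by unfold_locales (simp_all add: u_def field_simps)
  show ?thesis
    by (intro conjI exI, rule three_roots_not_irreducible[OF roots_P],
        rule three_roots_not_irreducible[OF roots_Q], rule roots_P, rule roots_Q, rule auxiliary,
        simp, rule not_solves)
qed

end
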